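(* Let $h$ and $w$ be any positive real numbers, and let $X$ be any symmetric real-valued random variable with $\operatorname{\mathsf{E}} X^2\in(0,\infty)$. Then $$0<\frac{\operatorname{\mathsf{E}} \big[X e^{h(X\wedge w)}\big]}{\operatorname{\mathsf{E}} \big[e^{h(X\wedge w)}\big]}<\frac{\sinh (hw)}{w}\,\operatorname{\mathsf{E}} X^2 .$$
   Context: Here $X\wedge w:=\min(X,w)$. A real-valued random variable $X$ is called symmetric if $X$ and $-X$ have the same distribution. $\operatorname{\mathsf{E}}$ denotes expectation. *)

theory Defs
  imports "HOL-Probability.Probability"
begin

definition symmetric_rv :: "'a measure \<Rightarrow> ('a \<Rightarrow> real) \<Rightarrow> bool" where
  "symmetric_rv M X \<longleftrightarrow> distr M borel X = distr M borel (\<lambda>\<omega>. - X \<omega>)"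

end

theory Submission
  imports Defs
begin

text \<open>
  Let \<open>N\<close> and \<open>D\<close> be the even parts of \<open>x * exp (h * min x w)\<close> and \<open>exp (h * min x w)\<close>. Symmetry
  of \<open>X\<close> turns the quotient into \<open>E N(X) / E D(X)\<close>. Both \<open>N\<close> (away from zero) and \<open>D\<close> are positive,
  which gives the lower bound. With \<open>s = sinh (h * w) / w\<close>, the upper bound says
  \<open>E N(X) < s * E X\<^sup>2 * E D(X)\<close>.

  If \<open>D \<ge> 1\<close> held everywhere, the pointwise bound \<open>N x \<le> s * x\<^sup>2\<close> would almost suffice. But \<open>D x\<close> tends
  to \<open>exp (h * w) / 2\<close> as \<open>x\<close> grows, which can be less than \<open>1\<close>. The remedy is to compare two
  independent copies of \<open>X\<close>: it is enough that
  \<open>N x + N y \<le> s * (x\<^sup>2 * D y + y\<^sup>2 * D x)\<close> for all \<open>x\<close> and \<open>y\<close>, strictly when both are nonzero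
  (lemma \<open>paired_bound\<close>). If \<open>D x\<close> and \<open>D y\<close> are at least \<open>1\<close>, this follows from
  \<open>N x \<le> s * x\<^sup>2\<close>. Otherwise one of the points lies beyond \<open>w\<close>, where \<open>D\<close> is decreasing, and then \<open>D\<close>
  and the square are oppositely ordered at \<open>x\<close>, \<open>y\<close>; by the rearrangement inequality
  the right-hand side is at least \<open>s * (x\<^sup>2 * D x + y\<^sup>2 * D y)\<close>, and the diagonal bound
  \<open>N x < s * x\<^sup>2 * D x\<close> finishes the argument. That diagonal bound is \<open>tanh t < t\<close> in disguise.
\<close>

section \<open>Symmetrization\<close>

definition even_part :: "(real \<Rightarrow> real) \<Rightarrow> real \<Rightarrow> real" where
  "even_part f x = (f x + f (- x)) / 2"

lemma even_part_abs: "even_part f \<bar>x\<bar> = even_part f x"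
  by (auto simp: even_part_def abs_if)

lemma symmetric_rv_expectation_uminus:
  fixes f :: "real \<Rightarrow> real"
  assumes "symmetric_rv M X" and [measurable]: "X \<in> borel_measurable M" "f \<in> borel_measurable borel"
  shows "(\<integral>\<omega>. f (- X \<omega>) \<partial>M) = (\<integral>\<omega>. f (X \<omega>) \<partial>M)"
proof -
  have "(\<integral>\<omega>. f (X \<omega>) \<partial>M) = integral\<^sup>L (distr M borel X) f"
    by (subst integral_distr) auto
  also have "\<dots> = integral\<^sup>L (distr M borel (\<lambda>\<omega>. - X \<omega>)) f"
    using assms(1) by (simp add: symmetric_rv_def)
  also have "\<dots> = (\<integral>\<omega>. f (- X \<omega>) \<partial>M)"
    by (subst integral_distr) auto
  finally show ?thesis by simp
qed

lemma symmetric_rv_expectation_even_part: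
  fixes f :: "real \<Rightarrow> real"
  assumes "symmetric_rv M X" "X \<in> borel_measurable M" "f \<in> borel_measurable borel"
    and "integrable M (\<lambda>\<omega>. f (X \<omega>))" "integrable M (\<lambda>\<omega>. f (- X \<omega>))"
  shows "integrable M (\<lambda>\<omega>. even_part f (X \<omega>))"
    and "(\<integral>\<omega>. even_part f (X \<omega>) \<partial>M) = (\<integral>\<omega>. f (X \<omega>) \<partial>M)"
  using assms symmetric_rv_expectation_uminus[OF assms(1-3)] by (simp_all add: even_part_def)

section \<open>Pointwise bounds for the truncated exponential\<close>

definition trunc_exp :: "real \<Rightarrow> real \<Rightarrow> real \<Rightarrow> real" where
  "trunc_exp h w x = exp (h * min x w)"

abbreviation tilt_num :: "real \<Rightarrow> real \<Rightarrow> real \<Rightarrow> real" where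
  "tilt_num h w \<equiv> even_part (\<lambda>x. x * trunc_exp h w x)"

abbreviation tilt_den :: "real \<Rightarrow> real \<Rightarrow> real \<Rightarrow> real" where
  "tilt_den h w \<equiv> even_part (trunc_exp h w)"

lemma tilt_den_pos: "0 < tilt_den h w x"
  by (simp add: even_part_def trunc_exp_def add_pos_pos)

lemma tilt_num_nonneg_arg:
  assumes "0 \<le> x" "0 < w"
  shows "tilt_num h w x = x * (exp (h * min x w) - exp (- (h * x))) / 2"
  using assms by (simp add: even_part_def trunc_exp_def min_def algebra_simps)

lemma tilt_den_nonneg_arg:
  assumes "0 \<le> x" "0 < w"
  shows "tilt_den h w x = (exp (h * min x w) + exp (- (h * x))) / 2"
  using assms by (simp add: even_part_def trunc_exp_def min_def)

lemma tilt_num_pos: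
  assumes "x \<noteq> 0" "0 < h" "0 < w"
  shows "0 < tilt_num h w x"
proof -
  have "- (h * \<bar>x\<bar>) < h * min \<bar>x\<bar> w"
    using assms by (smt (verit) mult_pos_pos zero_less_abs_iff)
  hence "0 < tilt_num h w \<bar>x\<bar>"
    using assms by (simp add: tilt_num_nonneg_arg)
  thus ?thesis by (simp only: even_part_abs)
qed

lemma tilt_den_ge_1:
  assumes "0 \<le> x" "x \<le> w" "0 < w"
  shows "1 \<le> tilt_den h w x"
  using assms cosh_real_ge_1[of "h * x"] by (simp add: tilt_den_nonneg_arg cosh_field_def)

lemma tilt_den_antimono:
  assumes "0 < h" "0 < w" "w \<le> x" "x \<le> y"
  shows "tilt_den h w y \<le> tilt_den h w x"
  using assms by (simp add: tilt_den_nonneg_arg min_absorb2)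

lemma convex_on_sinh: "convex_on {0..} (sinh :: real \<Rightarrow> real)"
proof (rule f''_ge0_imp_convex)
  show "(sinh has_real_derivative cosh x) (at x)" for x :: real
    by (auto intro!: derivative_eq_intros)
  show "(cosh has_real_derivative sinh x) (at x)" for x :: real
    by (auto intro!: derivative_eq_intros)
qed auto

lemma sinh_ge_self:
  assumes "0 \<le> (x::real)"
  shows "x \<le> sinh x"
proof -
  have "sinh 0 - 0 \<le> sinh x - x"
  proof (rule DERIV_nonneg_imp_nondecreasing[OF assms])
    show "\<exists>d. ((\<lambda>x. sinh x - x) has_real_derivative d) (at t) \<and> 0 \<le> d" for t :: real
      by (rule exI[of _ "cosh t - 1"])
         (auto intro!: derivative_eq_intros simp: cosh_real_ge_1)
  qed
  thus ?thesis by simp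
qed

lemma sinh_less_mult_cosh:
  assumes "0 < (t::real)"
  shows "sinh t < t * cosh t"
proof -
  have "0 * cosh 0 - sinh 0 < t * cosh t - sinh t"
  proof (rule DERIV_pos_imp_increasing_open[OF assms])
    show "\<exists>d. ((\<lambda>x. x * cosh x - sinh x) has_real_derivative d) (at x) \<and> 0 < d"
      if "0 < x" for x :: real
      using that by (intro exI[of _ "x * sinh x"]) (auto intro!: derivative_eq_intros)
  qed (auto intro!: continuous_intros)
  thus ?thesis by simp
qed

text \<open>
  Up to \<open>w\<close> the bound is convexity of \<open>sinh\<close>: its chord from \<open>0\<close> to \<open>h * w\<close> lies above it. Beyond \<open>w\<close> the
  numerator divided by \<open>x\<close> has slope at most \<open>h\<close>, while the chord, as a function of \<open>x\<close>, has slope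
  \<open>sinh (h * w) / w \<ge> h\<close>, so its extension stays above.
\<close>
lemma tilt_num_le:
  assumes "0 \<le> x" "0 < h" "0 < w"
  shows "tilt_num h w x \<le> sinh (h * w) / w * x\<^sup>2"
proof -
  have slope: "h \<le> sinh (h * w) / w"
    using sinh_ge_self[of "h * w"] assms by (simp add: field_simps)
  have "(exp (h * min x w) - exp (- (h * x))) / 2 \<le> sinh (h * w) / w * x"
  proof (cases "x \<le> w")
    case True
    have "sinh ((1 - x / w) * 0 + (x / w) * (h * w))
        \<le> (1 - x / w) * sinh 0 + (x / w) * sinh (h * w)"
      using convex_onD[OF convex_on_sinh, of "x / w" 0 "h * w"] True assms by simp
    thus ?thesis
      using True assms by (simp add: sinh_field_def mult_ac)
  next
    case False
    have "1 - h * (x - w) \<le> exp (- (h * (x - w)))"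
      using exp_ge_add_one_self[of "- (h * (x - w))"] by simp
    hence "exp (- (h * w)) * (1 - h * (x - w)) \<le> exp (- (h * w)) * exp (- (h * (x - w)))"
      by simp
    also have "\<dots> = exp (- (h * x))"
      by (simp add: exp_add[symmetric] algebra_simps)
    finally have *: "exp (- (h * w)) - exp (- (h * w)) * (h * (x - w)) \<le> exp (- (h * x))"
      by (simp add: algebra_simps)
    have "exp (- (h * w)) * (h * (x - w)) \<le> 1 * (h * (x - w))"
      using assms False by (intro mult_right_mono) auto
    hence "(exp (h * w) - exp (- (h * x))) / 2 \<le> sinh (h * w) + h * (x - w) / 2"
      using * by (simp add: sinh_field_def field_simps)
    also have "\<dots> \<le> sinh (h * w) + h * (x - w)"
      using assms False by simp
    also have "\<dots> \<le> sinh (h * w) + sinh (h * w) / w * (x - w)"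
      using slope False by (intro add_left_mono mult_right_mono) auto
    also have "\<dots> = sinh (h * w) / w * x"
      using assms by (simp add: field_simps)
    finally show ?thesis using False by simp
  qed
  from mult_left_mono[OF this assms(1)] show ?thesis
    using assms by (simp add: tilt_num_nonneg_arg power2_eq_square mult_ac)
qed

text \<open>
  Factoring out the geometric mean of the two exponentials leaves \<open>x * sinh t\<close> and \<open>cosh t\<close>, where
  \<open>t = h * (min x w + x) / 2 \<le> h * x\<close>; so the quotient is \<open>x * tanh t < x * t \<le> h * x\<^sup>2\<close>.
\<close>
lemma tilt_num_less_mult_tilt_den:
  assumes "0 < x" "0 < h" "0 < w"
  shows "tilt_num h w x < sinh (h * w) / w * x\<^sup>2 * tilt_den h w x"
proof -
  define t where "t = h * (min x w + x) / 2"
  define a where "a = h * (min x w - x) / 2"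
  have t: "0 < t" "t \<le> h * x"
    using assms by (auto simp: t_def add_pos_pos min_def field_simps)
  have hs: "h \<le> sinh (h * w) / w"
    using sinh_ge_self[of "h * w"] assms by (simp add: field_simps)
  have e: "exp (h * min x w) = exp a * exp t" "exp (- (h * x)) = exp a * exp (- t)"
    unfolding exp_add[symmetric] by (simp_all add: t_def a_def field_simps)
  have num: "tilt_num h w x = x * exp a * sinh t"
    using assms e by (simp add: tilt_num_nonneg_arg sinh_field_def algebra_simps)
  have den: "tilt_den h w x = exp a * cosh t"
    using assms e by (simp add: tilt_den_nonneg_arg cosh_field_def algebra_simps)
  have "tilt_num h w x < x * exp a * (t * cosh t)"
    unfolding num using sinh_less_mult_cosh[OF t(1)] assms by simp
  also have "\<dots> = x * t * tilt_den h w x"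
    by (simp add: den)
  also have "\<dots> \<le> x * (sinh (h * w) / w * x) * tilt_den h w x"
  proof (intro mult_right_mono mult_left_mono)
    show "t \<le> sinh (h * w) / w * x"
      using t(2) mult_right_mono[OF hs, of x] assms by linarith
  qed (use assms tilt_den_pos[of h w x] in auto)
  finally show ?thesis by (simp add: power2_eq_square mult_ac)
qed

section \<open>Comparing two points\<close>

text \<open>
  A denominator below \<open>1\<close> forces \<open>y > w\<close>. Points before \<open>w\<close> are then smaller than \<open>y\<close> with a larger
  denominator, and beyond \<open>w\<close> the denominator is decreasing.
\<close>
lemma tilt_den_opposite_order:
  assumes "0 \<le> x" "0 \<le> y" "0 < h" "0 < w" "tilt_den h w y < 1"
  shows "0 \<le> (y\<^sup>2 - x\<^sup>2) * (tilt_den h w x - tilt_den h w y)"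
proof -
  have "w < y"
    using tilt_den_ge_1[of y w h] assms by linarith
  consider "x \<le> w" | "w \<le> x" "x \<le> y" | "y \<le> x" by linarith
  thus ?thesis
  proof cases
    case 1
    thus ?thesis
      using tilt_den_ge_1[of x w h] assms \<open>w < y\<close>
      by (intro mult_nonneg_nonneg) (auto intro!: power_mono)
  next
    case 2
    thus ?thesis
      using tilt_den_antimono[of h w x y] assms
      by (intro mult_nonneg_nonneg) (auto intro!: power_mono)
  next
    case 3
    thus ?thesis
      using tilt_den_antimono[of h w y x] assms \<open>w < y\<close>
      by (intro mult_nonpos_nonpos) (auto intro!: power_mono)
  qed
qed

lemma paired_bound_pos:
  assumes "0 < x" "0 < y" "0 < h" "0 < w"
  shows "tilt_num h w x + tilt_num h w y
       < sinh (h * w) / w * (x\<^sup>2 * tilt_den h w y + y\<^sup>2 * tilt_den h w x)"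
proof -
  define s where "s = sinh (h * w) / w"
  have s: "0 < s"
    using assms by (simp add: s_def)
  have diag: "tilt_num h w x < s * x\<^sup>2 * tilt_den h w x" "tilt_num h w y < s * y\<^sup>2 * tilt_den h w y"
    using tilt_num_less_mult_tilt_den[of x h w] tilt_num_less_mult_tilt_den[of y h w] assms
    by (simp_all add: s_def)
  show ?thesis
  proof (cases "1 \<le> tilt_den h w x \<and> 1 \<le> tilt_den h w y")
    case True
    have le: "tilt_num h w x \<le> s * x\<^sup>2" "tilt_num h w y \<le> s * y\<^sup>2"
      using tilt_num_le[of x h w] tilt_num_le[of y h w] assms by (simp_all add: s_def)
    have x: "s * x\<^sup>2 \<le> s * x\<^sup>2 * tilt_den h w y" and y: "s * y\<^sup>2 \<le> s * y\<^sup>2 * tilt_den h w x"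
      using True s assms by simp_all
    (* Strictness: equality in N x \<le> s * x\<^sup>2 occurs (at x = w), but only where D x > 1. *)
    have "tilt_num h w x < s * x\<^sup>2 \<or> s * y\<^sup>2 < s * y\<^sup>2 * tilt_den h w x"
    proof (cases "tilt_den h w x = 1")
      case True
      thus ?thesis using diag by simp
    next
      case False
      thus ?thesis using True s assms by auto
    qed
    thus ?thesis
      using le x y unfolding s_def[symmetric] by (auto simp: distrib_left mult.assoc)
  next
    case False
    have "0 \<le> (y\<^sup>2 - x\<^sup>2) * (tilt_den h w x - tilt_den h w y)"
    proof (cases "tilt_den h w y < 1")
      case True
      thus ?thesis using tilt_den_opposite_order[of x y h w] assms by simp
    next
      case _: False
      thus ?thesis
        using False tilt_den_opposite_order[of y x h w] assms by (simp add: algebra_simps)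
    qed
    hence "x\<^sup>2 * tilt_den h w x + y\<^sup>2 * tilt_den h w y \<le> x\<^sup>2 * tilt_den h w y + y\<^sup>2 * tilt_den h w x"
      by (simp add: algebra_simps)
    from mult_left_mono[OF this, of s] show ?thesis
      using diag s unfolding s_def[symmetric] by (simp add: distrib_left mult.assoc)
  qed
qed

lemma paired_bound:
  assumes "0 < h" "0 < w"
  shows "tilt_num h w x + tilt_num h w y
       \<le> sinh (h * w) / w * (x\<^sup>2 * tilt_den h w y + y\<^sup>2 * tilt_den h w x)"
    and "x \<noteq> 0 \<Longrightarrow> y \<noteq> 0 \<Longrightarrow> tilt_num h w x + tilt_num h w y
       < sinh (h * w) / w * (x\<^sup>2 * tilt_den h w y + y\<^sup>2 * tilt_den h w x)"
proof -
  show strict: "tilt_num h w x + tilt_num h w y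
      < sinh (h * w) / w * (x\<^sup>2 * tilt_den h w y + y\<^sup>2 * tilt_den h w x)" if "x \<noteq> 0" "y \<noteq> 0"
    using paired_bound_pos[of "\<bar>x\<bar>" "\<bar>y\<bar>" h w] that assms by (simp add: even_part_abs)
  have zero: "tilt_num h w 0 = 0" "tilt_den h w 0 = 1"
    using assms by (simp_all add: even_part_def trunc_exp_def)
  have le: "tilt_num h w z \<le> sinh (h * w) / w * z\<^sup>2" for z
    using tilt_num_le[of "\<bar>z\<bar>" h w] assms by (simp add: even_part_abs)
  show "tilt_num h w x + tilt_num h w y
      \<le> sinh (h * w) / w * (x\<^sup>2 * tilt_den h w y + y\<^sup>2 * tilt_den h w x)"
  proof (cases "x = 0 \<or> y = 0")
    case True
    thus ?thesis using le[of x] le[of y] by (auto simp: zero)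
  qed (use strict in simp)
qed

section \<open>Integration\<close>

lemma integral_pos_of_pos_off_zero:
  fixes f X :: "'a \<Rightarrow> real"
  assumes "integrable M f" and "\<And>\<omega>. 0 \<le> f \<omega>" and "\<And>\<omega>. X \<omega> \<noteq> 0 \<Longrightarrow> 0 < f \<omega>"
    and "\<not> (AE \<omega> in M. X \<omega> = 0)"
  shows "0 < (\<integral>\<omega>. f \<omega> \<partial>M)"
proof -
  have "(\<integral>\<omega>. f \<omega> \<partial>M) \<noteq> 0"
  proof
    assume "(\<integral>\<omega>. f \<omega> \<partial>M) = 0"
    hence "AE \<omega> in M. f \<omega> = 0"
      using assms by (simp add: integral_nonneg_eq_0_iff_AE)
    hence "AE \<omega> in M. X \<omega> = 0"
      by (rule AE_mp) (use assms(3) in \<open>fastforce intro!: AE_I2\<close>)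
    with assms(4) show False by simp
  qed
  moreover have "0 \<le> (\<integral>\<omega>. f \<omega> \<partial>M)"
    using assms by (simp add: integral_nonneg_AE)
  ultimately show ?thesis by simp
qed

text \<open>
  Two independent copies are available without a product space: integrate out one variable with the
  other held fixed, then the other one.
\<close>
lemma (in prob_space) expectation_less_of_paired_bound:
  fixes X :: "'a \<Rightarrow> real" and N D q :: "real \<Rightarrow> real"
  assumes int: "integrable M (\<lambda>\<omega>. N (X \<omega>))" "integrable M (\<lambda>\<omega>. D (X \<omega>))" "integrable M (\<lambda>\<omega>. q (X \<omega>))"
    and le: "\<And>x y. N x + N y \<le> q x * D y + q y * D x"
    and less: "\<And>x y. x \<noteq> 0 \<Longrightarrow> y \<noteq> 0 \<Longrightarrow> N x + N y < q x * D y + q y * D x"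
    and nz: "\<not> (AE \<omega> in M. X \<omega> = 0)"
  shows "expectation (\<lambda>\<omega>. N (X \<omega>)) < expectation (\<lambda>\<omega>. q (X \<omega>)) * expectation (\<lambda>\<omega>. D (X \<omega>))"
proof -
  define n d r where "n = expectation (\<lambda>\<omega>. N (X \<omega>))" and "d = expectation (\<lambda>\<omega>. D (X \<omega>))"
    and "r = expectation (\<lambda>\<omega>. q (X \<omega>))"
  let ?F = "\<lambda>y x. q x * D y + q y * D x - (N x + N y)"
  have F_int: "integrable M (\<lambda>\<omega>. ?F y (X \<omega>))" for y
    using int by simp
  have F_eq: "expectation (\<lambda>\<omega>. ?F y (X \<omega>)) = r * D y + q y * d - (n + N y)" for y
    using int by (simp add: n_def d_def r_def prob_space)
  have "0 \<le> r * D y + q y * d - (n + N y)" for y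
    unfolding F_eq[symmetric] using le by (intro integral_nonneg_AE) simp
  moreover have "0 < r * D y + q y * d - (n + N y)" if "y \<noteq> 0" for y
    unfolding F_eq[symmetric]
    by (rule integral_pos_of_pos_off_zero[OF F_int _ _ nz]) (use le less that in auto)
  ultimately have "0 < expectation (\<lambda>\<omega>. r * D (X \<omega>) + q (X \<omega>) * d - (n + N (X \<omega>)))"
    using int nz by (intro integral_pos_of_pos_off_zero[where X = X]) auto
  also have "\<dots> = r * d + r * d - (n + n)"
    using int by (simp add: n_def d_def r_def prob_space)
  finally show ?thesis by (simp add: n_def d_def r_def mult.commute)
qed

theorem theorem1:
  fixes M :: "'a measure" and X :: "'a \<Rightarrow> real" and h w :: real
  assumes "prob_space M"
    and "X \<in> borel_measurable M"
    and "symmetric_rv M X"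
    and "integrable M (\<lambda>\<omega>. (X \<omega>)\<^sup>2)"
    and "0 < prob_space.expectation M (\<lambda>\<omega>. (X \<omega>)\<^sup>2)"
    and "0 < h" and "0 < w"
  shows "0 < prob_space.expectation M (\<lambda>\<omega>. X \<omega> * exp (h * min (X \<omega>) w))
              / prob_space.expectation M (\<lambda>\<omega>. exp (h * min (X \<omega>) w))
       \<and> prob_space.expectation M (\<lambda>\<omega>. X \<omega> * exp (h * min (X \<omega>) w))
              / prob_space.expectation M (\<lambda>\<omega>. exp (h * min (X \<omega>) w))
           < sinh (h * w) / w * prob_space.expectation M (\<lambda>\<omega>. (X \<omega>)\<^sup>2)"
proof -
  interpret prob_space M by fact
  note X [measurable] = assms(2)
  note hw = \<open>0 < h\<close> \<open>0 < w\<close>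
  define s where "s = sinh (h * w) / w"
  let ?N = "\<lambda>\<omega>. tilt_num h w (X \<omega>)" and ?D = "\<lambda>\<omega>. tilt_den h w (X \<omega>)"
  have nz: "\<not> (AE \<omega> in M. X \<omega> = 0)"
  proof
    assume "AE \<omega> in M. X \<omega> = 0"
    hence "expectation (\<lambda>\<omega>. (X \<omega>)\<^sup>2) = expectation (\<lambda>\<omega>. 0)"
      by (intro integral_cong_AE) auto
    with assms(5) show False by simp
  qed
  have [measurable]: "trunc_exp h w \<in> borel_measurable borel"
    unfolding trunc_exp_def by measurable
  have bound: "\<bar>trunc_exp h w x\<bar> \<le> exp (h * w)" for x
    using hw by (simp add: trunc_exp_def)
  have Xint: "integrable M X"
    using X assms(4) by (rule square_integrable_imp_integrable)
  have den_int: "integrable M (\<lambda>\<omega>. trunc_exp h w (Y \<omega>))"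
    if [measurable]: "Y \<in> borel_measurable M" for Y
    by (rule integrable_const_bound[where B = "exp (h * w)"]) (use bound in auto)
  have num_int: "integrable M (\<lambda>\<omega>. Y \<omega> * trunc_exp h w (Y \<omega>))" if Y: "integrable M Y" for Y
  proof (rule Bochner_Integration.integrable_bound)
    show "integrable M (\<lambda>\<omega>. exp (h * w) * Y \<omega>)" using Y by simp
    show "(\<lambda>\<omega>. Y \<omega> * trunc_exp h w (Y \<omega>)) \<in> borel_measurable M"
      using borel_measurable_integrable[OF Y] by measurable
    show "AE \<omega> in M. norm (Y \<omega> * trunc_exp h w (Y \<omega>)) \<le> norm (exp (h * w) * Y \<omega>)"
      using mult_left_mono[OF bound abs_ge_zero] by (intro AE_I2) (simp add: abs_mult mult.commute)
  qed
  have D: "integrable M ?D" "expectation ?D = expectation (\<lambda>\<omega>. exp (h * min (X \<omega>) w))"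
    using symmetric_rv_expectation_even_part[of M X "trunc_exp h w"] assms(3) den_int[of X]
      den_int[of "\<lambda>\<omega>. - X \<omega>"]
    by (simp_all add: trunc_exp_def)
  have N: "integrable M ?N" "expectation ?N = expectation (\<lambda>\<omega>. X \<omega> * exp (h * min (X \<omega>) w))"
    using symmetric_rv_expectation_even_part[of M X "\<lambda>x. x * trunc_exp h w x"] assms(3)
      num_int[of X] num_int[of "\<lambda>\<omega>. - X \<omega>"] Xint
    by (simp_all add: trunc_exp_def)
  have D_pos: "0 < expectation ?D"
    by (rule integral_pos_of_pos_off_zero[OF D(1) _ _ nz]) (simp_all add: tilt_den_pos less_imp_le)
  have "0 \<le> tilt_num h w x" for x
    using tilt_num_pos[of x h w] hw by (cases "x = 0") (auto simp: even_part_def)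
  hence N_pos: "0 < expectation ?N"
    by (intro integral_pos_of_pos_off_zero[OF N(1) _ _ nz]) (use hw in \<open>simp_all add: tilt_num_pos\<close>)
  have "expectation ?N < expectation (\<lambda>\<omega>. s * (X \<omega>)\<^sup>2) * expectation ?D"
    using paired_bound[OF hw]
    by (intro expectation_less_of_paired_bound[where N = "tilt_num h w" and D = "tilt_den h w"
          and q = "\<lambda>x. s * x\<^sup>2"])
       (use N D assms(4) nz in \<open>simp_all add: s_def distrib_left mult.assoc\<close>)
  thus ?thesis
    using N_pos D_pos unfolding N(2) D(2) s_def by (simp add: field_simps)
qed

end
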